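(* Let $n$ and $d$ be integers with $n > 2d \geq 1$. Then the only degree-$d$ polynomial endomorphisms of $\mu_n$ in $\mathbb{C}[x]$ are those of the form $\zeta_n^k x^d$ for some $k\geq 0$.
   Context: $\mu_n\subset\mathbb{C}$ is the set of $n$th roots of unity and $\zeta_n\in\mu_n$ is a primitive $n$th root of unity. A polynomial endomorphism of $\mu_n$ is a polynomial $f(x)\in\mathbb{C}[x]$ such that $f(\mu_n)\subseteq\mu_n$. *)

theory Defs
  imports Complex_Main "HOL-Computational_Algebra.Polynomial"
begin

definition unity_roots :: "nat \<Rightarrow> complex set" where
  "unity_roots n = {z. z ^ n = 1}"

definition primitive_unity_root :: "nat \<Rightarrow> complex \<Rightarrow> bool" where
  "primitive_unity_root n z \<longleftrightarrow>
     z \<in> unity_roots n \<and> (\<forall>m. 0 < m \<and> m < n \<longrightarrow> z ^ m \<noteq> 1)"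

definition poly_endomorphism :: "nat \<Rightarrow> complex poly \<Rightarrow> bool" where
  "poly_endomorphism n f \<longleftrightarrow> poly f ` unity_roots n \<subseteq> unity_roots n"

end

theory Submission
  imports Defs
begin

text \<open>
  On the unit circle \<open>cnj z = 1 / z\<close>, so for \<open>z\<close> in \<open>\<mu>\<^sub>n\<close> the equation \<open>\<bar>f z\<bar>\<^sup>2 = 1\<close> becomes,
  after multiplication by \<open>z\<^sup>d\<close>, the polynomial equation \<open>f z * g z = z\<^sup>d\<close>, where \<open>g\<close> is the
  conjugate reciprocal polynomial of \<open>f\<close>: its coefficients are those of \<open>f\<close>, conjugated and in
  reverse order. Both sides have degree at most \<open>2 * d\<close> and agree at the \<open>n > 2 * d\<close> points of
  \<open>\<mu>\<^sub>n\<close>, so \<open>f * g\<close> is the monomial of degree \<open>d\<close>. As \<open>f\<close> already has degree \<open>d\<close>, the factor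
  \<open>g\<close> is a constant and \<open>f\<close> is a monomial (lemma \<open>unimodular_on_unity_roots_imp_monom\<close>).
  Its coefficient is the value of \<open>f\<close> at \<open>1\<close>, hence an \<open>n\<close>th root of unity, and these are the
  powers of \<open>\<zeta>\<close>.
\<close>

definition conj_reciprocal :: "complex poly \<Rightarrow> complex poly" where
  "conj_reciprocal f = reflect_poly (map_poly cnj f)"

lemma degree_conj_reciprocal_le: "degree (conj_reciprocal f) \<le> degree f"
proof -
  have "degree (map_poly cnj f) = degree f"
    by (rule degree_map_poly) simp
  then show ?thesis
    using degree_reflect_poly_le[of "map_poly cnj f"] by (simp add: conj_reciprocal_def)
qed

lemma poly_map_poly_cnj: "poly (map_poly cnj f) (cnj z) = cnj (poly f z)"
  by (induction f) (auto simp: map_poly_pCons)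

lemma poly_conj_reciprocal_on_circle:
  assumes "norm z = 1"
  shows "poly (conj_reciprocal f) z = z ^ degree f * cnj (poly f z)"
proof -
  have "z * cnj z = 1"
    using assms by (simp add: complex_norm_square[symmetric])
  then have "inverse z = cnj z"
    by (rule inverse_unique)
  moreover have "z \<noteq> 0"
    using assms by auto
  moreover have "degree (map_poly cnj f) = degree f"
    by (rule degree_map_poly) simp
  ultimately show ?thesis
    by (simp add: conj_reciprocal_def poly_reflect_poly_nz poly_map_poly_cnj)
qed

lemma norm_unity_root:
  assumes "n > 0" and "z \<in> unity_roots n"
  shows "norm z = 1"
  using assms power_eq_1_iff[of z n] by (auto simp: unity_roots_def)

text \<open>
  The product of \<open>f\<close> and its conjugate reciprocal has degree at most \<open>2 * degree f < n\<close>, so its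
  values on \<open>\<mu>\<^sub>n\<close>, which are \<open>z ^ degree f * \<bar>f z\<bar>\<^sup>2 = z ^ degree f\<close>, determine it.
\<close>

lemma unimodular_on_unity_roots_imp_monom:
  fixes f :: "complex poly"
  assumes n: "2 * degree f < n"
    and unimodular: "\<And>z. z \<in> unity_roots n \<Longrightarrow> norm (poly f z) = 1"
  shows "\<exists>c. f = monom c (degree f)"
proof -
  define g where "g = conj_reciprocal f"
  have deg_g: "degree g \<le> degree f"
    unfolding g_def by (rule degree_conj_reciprocal_le)
  have "n > 0"
    using n by simp
  have card_roots: "card (unity_roots n) = n"
    unfolding unity_roots_def using \<open>n > 0\<close> by (rule card_roots_unity_eq)
  have fg: "f * g = monom 1 (degree f)"
  proof (rule poly_eqI_degree[where A = "unity_roots n"])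
    fix z assume z: "z \<in> unity_roots n"
    have "poly f z * cnj (poly f z) = 1"
      using unimodular[OF z] by (simp add: complex_norm_square[symmetric])
    then show "poly (f * g) z = poly (monom 1 (degree f)) z"
      using poly_conj_reciprocal_on_circle[OF norm_unity_root[OF \<open>n > 0\<close> z], of f]
      by (simp add: g_def poly_monom algebra_simps)
  next
    show "degree (f * g) < card (unity_roots n)"
      using degree_mult_le[of f g] deg_g n card_roots by linarith
    show "degree (monom 1 (degree f) :: complex poly) < card (unity_roots n)"
      using n card_roots by (simp add: degree_monom_eq)
  qed
  then have "f * g \<noteq> 0"
    by (simp add: monom_eq_0_iff)
  then have "degree f + degree g = degree f"
    using arg_cong[OF fg, of degree] by (simp add: degree_mult_eq degree_monom_eq)
  then obtain a where a: "g = [:a:]"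
    by (auto elim: degree_eq_zeroE)
  with \<open>f * g \<noteq> 0\<close> have "a \<noteq> 0"
    by auto
  have "smult a f = monom 1 (degree f)"
    using fg a by simp
  then have "smult (inverse a) (smult a f) = smult (inverse a) (monom 1 (degree f))"
    by (rule arg_cong)
  then have "f = monom (inverse a) (degree f)"
    using \<open>a \<noteq> 0\<close> by (simp add: smult_monom)
  then show ?thesis ..
qed

text \<open>
  The powers of \<open>\<zeta>\<close> with exponent below \<open>n\<close> are distinct, so they exhaust the \<open>n\<close> roots of unity.
\<close>

lemma unity_root_eq_power_of_primitive:
  assumes "n > 0" and prim: "primitive_unity_root n \<zeta>" and z: "z \<in> unity_roots n"
  shows "\<exists>k. z = \<zeta> ^ k"
proof -
  have \<zeta>: "\<zeta> ^ n = 1" and min: "\<And>m. 0 < m \<Longrightarrow> m < n \<Longrightarrow> \<zeta> ^ m \<noteq> 1"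
    using prim by (auto simp: primitive_unity_root_def unity_roots_def)
  have "\<zeta> \<noteq> 0"
    using \<zeta> \<open>n > 0\<close> by (auto simp: power_0_left)
  have card_roots: "card (unity_roots n) = n"
    unfolding unity_roots_def using \<open>n > 0\<close> by (rule card_roots_unity_eq)
  have "inj_on (\<lambda>k. \<zeta> ^ k) {..<n}"
  proof (rule linorder_inj_onI)
    fix i j assume "i < j" and "j \<in> {..<n}"
    then have "\<zeta> ^ (j - i) \<noteq> 1"
      by (intro min) auto
    moreover have "\<zeta> ^ j = \<zeta> ^ i * \<zeta> ^ (j - i)"
      using \<open>i < j\<close> by (simp add: power_add[symmetric])
    ultimately show "\<zeta> ^ i \<noteq> \<zeta> ^ j"
      using \<open>\<zeta> \<noteq> 0\<close> by simp
  qed auto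
  then have "card ((\<lambda>k. \<zeta> ^ k) ` {..<n}) = card (unity_roots n)"
    by (simp add: card_image card_roots)
  moreover have "(\<lambda>k. \<zeta> ^ k) ` {..<n} \<subseteq> unity_roots n"
    using \<zeta> by (auto simp: unity_roots_def simp flip: power_mult)
      (metis mult.commute power_mult power_one)
  moreover have "finite (unity_roots n)"
    using card_roots \<open>n > 0\<close> by (auto intro: card_ge_0_finite)
  ultimately have "(\<lambda>k. \<zeta> ^ k) ` {..<n} = unity_roots n"
    by (intro card_subset_eq)
  with z show ?thesis
    by auto
qed

theorem theorem1p8:
  fixes n d :: nat and \<zeta> :: complex
  assumes "n > 2 * d" and "2 * d \<ge> 1"
    and "primitive_unity_root n \<zeta>"
  shows "{f :: complex poly. degree f = d \<and> poly_endomorphism n f} =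
         {f. \<exists>k::nat. f = monom (\<zeta> ^ k) d}"
proof (intro equalityI subsetI CollectI; elim CollectE conjE exE)
  fix f :: "complex poly"
  assume deg: "degree f = d" and endo: "poly_endomorphism n f"
  have "n > 0"
    using assms(1) by simp
  have maps: "poly f z \<in> unity_roots n" if "z \<in> unity_roots n" for z
    using endo that by (auto simp: poly_endomorphism_def)
  obtain c where c: "f = monom c d"
    using unimodular_on_unity_roots_imp_monom[of f n] assms(1) deg
      norm_unity_root[OF \<open>n > 0\<close> maps] by auto
  have "c \<in> unity_roots n"
    using maps[of 1] by (simp add: c poly_monom unity_roots_def)
  then show "\<exists>k. f = monom (\<zeta> ^ k) d"
    using unity_root_eq_power_of_primitive[OF \<open>n > 0\<close> assms(3)] c by blast
next
  fix f and k :: nat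
  assume f: "f = monom (\<zeta> ^ k) d"
  have \<zeta>: "\<zeta> ^ n = 1"
    using assms(3) by (simp add: primitive_unity_root_def unity_roots_def)
  then have "\<zeta> \<noteq> 0"
    using assms(1) by (auto simp: power_0_left)
  then have "degree f = d"
    by (simp add: f degree_monom_eq)
  moreover have "(\<zeta> ^ k * z ^ d) ^ n = 1" if "z ^ n = 1" for z
  proof -
    have "(\<zeta> ^ k * z ^ d) ^ n = (\<zeta> ^ n) ^ k * (z ^ n) ^ d"
      by (simp add: power_mult_distrib power_mult[symmetric] mult.commute)
    then show ?thesis
      using \<zeta> that by simp
  qed
  then have "poly_endomorphism n f"
    by (auto simp: poly_endomorphism_def unity_roots_def f poly_monom)
  ultimately show "degree f = d \<and> poly_endomorphism n f" ..
qed

end
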